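(* Let $q>3$ be an odd prime power, $n\ge1$, $k=\mathbb{F}_q$, $K=\mathbb{F}_{q^2}$, $A_n=M_n(K)$ with involution $(a^* )_{ij}=\overline{a_{ji}}$, and let $G=SL_*^{-1}(2,A_n)\cong U(n,n)(K/k)$. Let $(\mathbb{C}^M,\rho)$ be the generalized Weil representation of $G$ and $\mathcal U$ the unitary group of the pair $(\chi,\gamma)$, both described in the context. Then for every irreducible complex representation $(V_\pi,\pi)$ of $\mathcal U$, the component $\mathrm{Hom}_{\mathcal U}(\mathbb{C}^M,V_\pi)$ of the initial decomposition $$\mathbb{C}^M\cong\bigoplus_{(V_\pi,\pi)\in\widehat{\mathcal U}} m_\pi\,\mathrm{Hom}_{\mathcal U}(\mathbb{C}^M,V_\pi),\qquad m_\pi=\dim_{\mathbb{C}}V_\pi,$$ is an irreducible representation of $G$.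
   Context: Here $\lambda\mapsto\overline{\lambda}$ is the nontrivial $k$-automorphism of $K$; for a row vector $y$ over $K$, $y^*$ is the conjugate transpose. **The group.** $SL_*^{-1}(2,A_n)$ is the group of all matrices $\begin{pmatrix}a&b\\ c&d\end{pmatrix}$ with entries in $A_n$ satisfying $a^*c=c^*a$, $ab^*=ba^*$, $b^*d=d^*b$, $cd^*=dc^*$, and $ad^*-bc^*=a^*d-c^*b=1$; it is isomorphic to $U(n,n)(K/k)$, the isometry group of the hermitian form $x\begin{pmatrix}0&I_n\\ I_n&0\end{pmatrix}y^*$ on $K^{2n}$. It is generated by $h_t=\begin{pmatrix}t&0\\ 0&(t^* )^{-1}\end{pmatrix}$ ($t\in A_n^\times$), $w=\begin{pmatrix}0&1\\ -1&0\end{pmatrix}$, $u_s=\begin{pmatrix}1&s\\ 0&1\end{pmatrix}$ ($s\in A_n$, $s^*=s$). **The representation.** Let $\psi$ be a nontrivial character of $K^+$ with $\psi(\lambda)=\psi(\overline\lambda)$ for all $\lambda$. Let $M=K^n$ (row vectors, right $A_n$-module), $\langle x,y\rangle=xy^*$, $\chi(x,y)=\psi(\langle x,y\rangle)$, $\gamma(u,x)=\psi(2^{-1}\langle xu,x\rangle)$ for $u\in A_n$ with $u^*=u$, $\alpha(t)=\mathrm{sgn}(\det t)$ for $t\in A_n^\times$ with $\mathrm{sgn}$ the nontrivial quadratic character of $K^\times$, and $c=-1/q^n$. For $a\in M$ let $e_a\in\mathbb{C}^M$ be the delta function at $a$. Then $\rho$ is the representation of $G$ on $\mathbb{C}^M$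 given on generators by $\rho_{u_s}(e_a)=\gamma(s,a)e_a$, $\rho_{h_t}(e_a)=\alpha(t)e_{at^{-1}}$, $\rho_w(e_a)=c\sum_{b\in M}\chi(a,b)e_b$. **The components.** $\mathcal U=U(\chi,\gamma)$ is the group of $A_n$-linear automorphisms $\beta$ of $M$ with $\gamma(b,\beta(x))=\gamma(b,x)$ for all $b\in A_n$ with $b^*=b$ and all $x\in M$. It acts on $\mathbb{C}^M$ by $(\sigma_\beta f)(x)=f(\beta^{-1}(x))$, and this action commutes with $\rho$. For an irreducible representation $(V_\pi,\pi)$ of $\mathcal U$, the space $\mathrm{Hom}_{\mathcal U}(\mathbb{C}^M,V_\pi)$ is identified (via $\theta(x)=\Theta(e_x)$) with the space of functions $\theta:M\to V_\pi$ with $\theta(\beta(x))=\pi(\beta)\theta(x)$ for all $\beta\in\mathcal U$, $x\in M$. Writing $(\rho_gf)(x)=\sum_{y\in M}K_g(x,y)f(y)$ with scalars $K_g(x,y)\in\mathbb{C}$, the group $G$ acts on this space by $(\widehat\rho_g\theta)(x)=\sum_{y\in M}K_g(x,y)\theta(y)$.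
   Formalization: For even n no representation has the stated constant c = -1/q^n, because (w u_1)^3 = 1 forces c = (-1)^n/q^n; the formal statement therefore allows c to be either -1/q^n or (-1)^n/q^n, and these agree for odd n. *)

theory Defs
  imports "HOL-Analysis.Analysis" "HOL-Algebra.Group" "HOL-Number_Theory.Prime_Powers"
begin

section \<open>Fields, involution and characters\<close>

definition is_subfield :: "'a::field set \<Rightarrow> bool" where
  "is_subfield k \<longleftrightarrow> 0 \<in> k \<and> 1 \<in> k \<and>
     (\<forall>x\<in>k. \<forall>y\<in>k. x + y \<in> k \<and> x * y \<in> k) \<and> (\<forall>x\<in>k. - x \<in> k \<and> inverse x \<in> k)"

definition nontrivial_automorphism_over :: "'a::field set \<Rightarrow> ('a \<Rightarrow> 'a) \<Rightarrow> bool" where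
  "nontrivial_automorphism_over k bar \<longleftrightarrow> bij bar \<and>
     (\<forall>x y. bar (x + y) = bar x + bar y \<and> bar (x * y) = bar x * bar y) \<and>
     (\<forall>x\<in>k. bar x = x) \<and> bar \<noteq> id"

definition nontrivial_additive_character :: "('a::field \<Rightarrow> complex) \<Rightarrow> bool" where
  "nontrivial_additive_character \<psi> \<longleftrightarrow>
     \<psi> 0 = 1 \<and> (\<forall>x y. \<psi> (x + y) = \<psi> x * \<psi> y) \<and> (\<exists>x. \<psi> x \<noteq> 1)"

text \<open>A character of the multiplicative group; the value at \<open>0\<close> is irrelevant.\<close>

definition nontrivial_quadratic_character :: "('a::field \<Rightarrow> complex) \<Rightarrow> bool" where
  "nontrivial_quadratic_character sgn' \<longleftrightarrow>
     (\<forall>x y. x \<noteq> 0 \<longrightarrow> y \<noteq> 0 \<longrightarrow> sgn' (x * y) = sgn' x * sgn' y) \<and>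
     (\<forall>x. x \<noteq> 0 \<longrightarrow> sgn' x ^ 2 = 1) \<and> (\<exists>x. x \<noteq> 0 \<and> sgn' x \<noteq> 1)"

section \<open>Representations\<close>

text \<open>
  The representation space is a subspace \<open>V\<close> of an ambient complex vector space with scalar
  multiplication \<open>scl\<close>; only the restriction of \<open>\<rho> g\<close> to \<open>V\<close> matters.
\<close>

definition is_rep ::
  "('g, 'x) monoid_scheme \<Rightarrow> (complex \<Rightarrow> 'v::ab_group_add \<Rightarrow> 'v) \<Rightarrow> 'v set \<Rightarrow> ('g \<Rightarrow> 'v \<Rightarrow> 'v) \<Rightarrow> bool"
where
  "is_rep G scl V \<rho> \<longleftrightarrow>
     vector_space scl \<and> module.subspace scl V \<and>
     (\<forall>g\<in>carrier G. \<forall>v\<in>V. \<rho> g v \<in> V) \<and>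
     (\<forall>g\<in>carrier G. \<forall>v\<in>V. \<forall>w\<in>V. \<rho> g (v + w) = \<rho> g v + \<rho> g w) \<and>
     (\<forall>g\<in>carrier G. \<forall>r. \<forall>v\<in>V. \<rho> g (scl r v) = scl r (\<rho> g v)) \<and>
     (\<forall>v\<in>V. \<rho> \<one>\<^bsub>G\<^esub> v = v) \<and>
     (\<forall>g\<in>carrier G. \<forall>h\<in>carrier G. \<forall>v\<in>V. \<rho> (g \<otimes>\<^bsub>G\<^esub> h) v = \<rho> g (\<rho> h v))"

definition is_irrep ::
  "('g, 'x) monoid_scheme \<Rightarrow> (complex \<Rightarrow> 'v::ab_group_add \<Rightarrow> 'v) \<Rightarrow> 'v set \<Rightarrow> ('g \<Rightarrow> 'v \<Rightarrow> 'v) \<Rightarrow> bool"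
where
  "is_irrep G scl V \<rho> \<longleftrightarrow> is_rep G scl V \<rho> \<and> V \<noteq> {0} \<and>
     (\<forall>W. module.subspace scl W \<longrightarrow> W \<subseteq> V \<longrightarrow> (\<forall>g\<in>carrier G. \<forall>v\<in>W. \<rho> g v \<in> W) \<longrightarrow>
          W = {0} \<or> W = V)"

section \<open>The group \<open>SL\<^sub>*\<^sup>-\<^sup>1(2,A\<^sub>n)\<close>\<close>

definition star :: "('a \<Rightarrow> 'a) \<Rightarrow> 'a^'n^'n \<Rightarrow> 'a^'n^'n" where
  "star bar A = (\<chi> i j. bar (A $ j $ i))"

text \<open>
  The tuple \<open>(a, b, c, d)\<close> is the block matrix with rows \<open>(a b)\<close> and \<open>(c d)\<close>. Blocks are multiplied
  with \<open>**\<close>, and \<open>mat 1\<close> is the identity matrix: on the type of matrices the class operations \<open>*\<close>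
  and \<open>1\<close> are componentwise.
\<close>

type_synonym ('a, 'n) block = "('a^'n^'n) \<times> ('a^'n^'n) \<times> ('a^'n^'n) \<times> ('a^'n^'n)"

fun block_mult :: "('a::field, 'n::finite) block \<Rightarrow> ('a, 'n) block \<Rightarrow> ('a, 'n) block" where
  "block_mult (a, b, c, d) (a', b', c', d') =
     (a ** a' + b ** c', a ** b' + b ** d', c ** a' + d ** c', c ** b' + d ** d')"

definition SLstar :: "('a::field \<Rightarrow> 'a) \<Rightarrow> ('a, 'n::finite) block monoid" where
  "SLstar bar =
     \<lparr> carrier = {(a, b, c, d).
         star bar a ** c = star bar c ** a \<and>
         a ** star bar b = b ** star bar a \<and>
         star bar b ** d = star bar d ** b \<and>
         c ** star bar d = d ** star bar c \<and>
         a ** star bar d - b ** star bar c = mat 1 \<and>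
         star bar a ** d - star bar c ** b = mat 1},
       mult = block_mult,
       one = (mat 1, 0, 0, mat 1) \<rparr>"

definition h_elt :: "('a::field \<Rightarrow> 'a) \<Rightarrow> 'a^'n^'n \<Rightarrow> ('a, 'n::finite) block" where
  "h_elt bar t = (t, 0, 0, matrix_inv (star bar t))"

definition w_elt :: "('a::field, 'n::finite) block" where
  "w_elt = (0, mat 1, - mat 1, 0)"

definition u_elt :: "'a::field^'n^'n \<Rightarrow> ('a, 'n::finite) block" where
  "u_elt s = (mat 1, s, 0, mat 1)"

section \<open>The generalized Weil representation\<close>

definition herm_form :: "('a::field \<Rightarrow> 'a) \<Rightarrow> 'a^'n::finite \<Rightarrow> 'a^'n \<Rightarrow> 'a" where
  "herm_form bar x y = (\<Sum>i\<in>UNIV. x $ i * bar (y $ i))"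

definition weil_chi :: "('a::field \<Rightarrow> 'a) \<Rightarrow> ('a \<Rightarrow> complex) \<Rightarrow> 'a^'n::finite \<Rightarrow> 'a^'n \<Rightarrow> complex" where
  "weil_chi bar \<psi> x y = \<psi> (herm_form bar x y)"

definition weil_gamma ::
  "('a::field \<Rightarrow> 'a) \<Rightarrow> ('a \<Rightarrow> complex) \<Rightarrow> 'a^'n^'n \<Rightarrow> 'a^'n::finite \<Rightarrow> complex" where
  "weil_gamma bar \<psi> u x = \<psi> (inverse 2 * herm_form bar (x v* u) x)"

text \<open>
  \<open>\<complex>\<^sup>M\<close> is the type \<open>complex^('a^'n)\<close>: vectors indexed by the finite type \<open>M = 'a^'n\<close>. The delta
  function at \<open>a\<close> is \<open>axis a 1\<close>.

  The normalising constant \<open>c\<close> is a parameter. The relation \<open>(w u\<^sub>1)\<^sup>3 = 1\<close> forces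
  \<open>c = (-1)\<^sup>n/q\<^sup>n\<close> with \<open>n = CARD('n)\<close>, which is \<open>-1/q\<^sup>n\<close> precisely for odd \<open>n\<close>; for even \<open>n\<close> no
  representation with \<open>c = -1/q\<^sup>n\<close> exists.
\<close>

definition is_weil_rep ::
  "('a::{field,finite} \<Rightarrow> 'a) \<Rightarrow> ('a \<Rightarrow> complex) \<Rightarrow> ('a \<Rightarrow> complex) \<Rightarrow> complex \<Rightarrow>
   (('a, 'n::finite) block \<Rightarrow> complex^('a^'n) \<Rightarrow> complex^('a^'n)) \<Rightarrow> bool"
where
  "is_weil_rep bar \<psi> sgn' c \<rho> \<longleftrightarrow>
     is_rep (SLstar bar) (*s) UNIV \<rho> \<and>
     (\<forall>s a. star bar s = s \<longrightarrow>
        \<rho> (u_elt s) (axis a 1) = weil_gamma bar \<psi> s a *s axis a 1) \<and>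
     (\<forall>t a. invertible t \<longrightarrow>
        \<rho> (h_elt bar t) (axis a 1) = sgn' (det t) *s axis (a v* matrix_inv t) 1) \<and>
     (\<forall>a. \<rho> w_elt (axis a 1) = c *s (\<Sum>b\<in>UNIV. weil_chi bar \<psi> a b *s axis b 1))"

section \<open>The unitary group and the components\<close>

definition unitary_pair ::
  "('a::field \<Rightarrow> 'a) \<Rightarrow> ('a \<Rightarrow> complex) \<Rightarrow> ('a^'n::finite \<Rightarrow> 'a^'n) monoid" where
  "unitary_pair bar \<psi> =
     \<lparr> carrier = {\<beta>. bij \<beta> \<and> (\<forall>x y. \<beta> (x + y) = \<beta> x + \<beta> y) \<and>
         (\<forall>x (u :: 'a^'n^'n). \<beta> (x v* u) = \<beta> x v* u) \<and>
         (\<forall>(b :: 'a^'n^'n) x. star bar b = b \<longrightarrow> weil_gamma bar \<psi> b (\<beta> x) = weil_gamma bar \<psi> b x)},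
       mult = (\<circ>),
       one = id \<rparr>"

definition sigma :: "('m::finite \<Rightarrow> 'm) \<Rightarrow> complex^'m \<Rightarrow> complex^'m" where
  "sigma \<beta> f = (\<chi> x. f $ (inv_into UNIV \<beta> x))"

definition hom_space ::
  "('m::finite \<Rightarrow> 'm) monoid \<Rightarrow> (complex \<Rightarrow> 'v::ab_group_add \<Rightarrow> 'v) \<Rightarrow> 'v set \<Rightarrow>
   (('m \<Rightarrow> 'm) \<Rightarrow> 'v \<Rightarrow> 'v) \<Rightarrow> (complex^'m \<Rightarrow> 'v) set"
where
  "hom_space U scl V \<pi> =
     {\<Theta>. Vector_Spaces.linear (*s) scl \<Theta> \<and> range \<Theta> \<subseteq> V \<and>
         (\<forall>\<beta>\<in>carrier U. \<forall>f. \<Theta> (sigma \<beta> f) = \<pi> \<beta> (\<Theta> f))}"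

text \<open>
  The space of functions \<open>\<theta> : M \<rightarrow> V\<close> with \<open>\<theta>(\<beta>(x)) = \<pi>(\<beta>)\<theta>(x)\<close>, with functions on \<open>M\<close> again
  given as vectors indexed by \<open>M\<close>. The lemma \<open>bij_betw_hom_space_component\<close> below identifies it
  with \<open>hom_space\<close>.
\<close>

definition component ::
  "('m::finite \<Rightarrow> 'm) monoid \<Rightarrow> 'v set \<Rightarrow> (('m \<Rightarrow> 'm) \<Rightarrow> 'v \<Rightarrow> 'v) \<Rightarrow> ('v^'m) set"
where
  "component U V \<pi> =
     {\<theta>. (\<forall>x. \<theta> $ x \<in> V) \<and> (\<forall>\<beta>\<in>carrier U. \<forall>x. \<theta> $ (\<beta> x) = \<pi> \<beta> (\<theta> $ x))}"

definition pointwise_scale :: "(complex \<Rightarrow> 'v \<Rightarrow> 'v) \<Rightarrow> complex \<Rightarrow> 'v^'m \<Rightarrow> 'v^'m" where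
  "pointwise_scale scl r \<theta> = (\<chi> x. scl r (\<theta> $ x))"

text \<open>The kernel \<open>K\<^sub>g(x,y)\<close> of a linear operator on \<open>\<complex>\<^sup>M\<close> is its matrix entry at \<open>(x,y)\<close>.\<close>

definition rho_hat ::
  "('g \<Rightarrow> complex^'m \<Rightarrow> complex^'m) \<Rightarrow> (complex \<Rightarrow> 'v::ab_group_add \<Rightarrow> 'v) \<Rightarrow>
   'g \<Rightarrow> 'v^'m::finite \<Rightarrow> 'v^'m"
where
  "rho_hat \<rho> scl g \<theta> = (\<chi> x. \<Sum>y\<in>UNIV. scl (matrix (\<rho> g) $ x $ y) (\<theta> $ y))"

lemma sigma_axis:
  assumes "bij \<beta>"
  shows "sigma \<beta> (axis x 1) = axis (\<beta> x) 1"
proof -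
  have "inv_into UNIV \<beta> y = x \<longleftrightarrow> y = \<beta> x" for y
    using assms by (metis bij_inv_eq_iff)
  then show ?thesis
    by (simp add: sigma_def axis_def vec_eq_iff)
qed

lemma sum_axis_expansion:
  fixes f :: "complex^'m::finite"
  shows "f = (\<Sum>x\<in>UNIV. f $ x *s axis x 1)"
  by (simp add: vec_eq_iff axis_def if_distrib sum.delta cong: if_cong)

lemma bij_betw_hom_space_component:
  fixes U :: "('m::finite \<Rightarrow> 'm) monoid" and scl :: "complex \<Rightarrow> 'v::ab_group_add \<Rightarrow> 'v"
  assumes rep: "is_rep U scl V \<pi>"
    and bij: "\<And>\<beta>. \<beta> \<in> carrier U \<Longrightarrow> bij \<beta>"
  shows "bij_betw (\<lambda>\<Theta>. \<chi> x. \<Theta> (axis x 1)) (hom_space U scl V \<pi>) (component U V \<pi>)"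
proof -
  interpret V: vector_space scl
    using rep by (simp add: is_rep_def)
  define ext :: "'v^'m \<Rightarrow> complex^'m \<Rightarrow> 'v"
    where "ext \<theta> f = (\<Sum>x\<in>UNIV. scl (f $ x) (\<theta> $ x))" for \<theta> f
  have subV: "V.subspace V"
    using rep by (simp add: is_rep_def)
  have ext_axis: "ext \<theta> (axis x 1) = \<theta> $ x" for \<theta> x
  proof -
    have "ext \<theta> (axis x 1) = (\<Sum>y\<in>UNIV. if y = x then \<theta> $ y else 0)"
      unfolding ext_def axis_def by (intro sum.cong) auto
    then show ?thesis by simp
  qed
  have left: "ext (\<chi> x. \<Theta> (axis x 1)) = \<Theta>" if "\<Theta> \<in> hom_space U scl V \<pi>" for \<Theta>
  proof
    fix f
    interpret T: Vector_Spaces.linear "(*s)" scl \<Theta>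
      using that by (simp add: hom_space_def)
    have "\<Theta> f = \<Theta> (\<Sum>x\<in>UNIV. f $ x *s axis x 1)"
      using sum_axis_expansion[of f] by simp
    also have "\<dots> = ext (\<chi> x. \<Theta> (axis x 1)) f"
      by (simp add: T.sum T.scale ext_def)
    finally show "ext (\<chi> x. \<Theta> (axis x 1)) f = \<Theta> f" by simp
  qed
  have pi_sum: "\<pi> \<beta> (sum g A) = (\<Sum>x\<in>A. \<pi> \<beta> (g x))"
    if "\<beta> \<in> carrier U" "finite A" "\<And>x. g x \<in> V" for \<beta> g and A :: "'m set"
    using that(2)
  proof (induction A rule: finite_induct)
    case empty
    have "0 \<in> V" using subV by (simp add: V.subspace_0)
    then have "\<pi> \<beta> (scl 0 0) = scl 0 (\<pi> \<beta> 0)"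
      using rep that(1) unfolding is_rep_def by blast
    then show ?case by simp
  next
    case (insert x F)
    have "sum g F \<in> V" by (intro V.subspace_sum subV that(3))
    then have "\<pi> \<beta> (g x + sum g F) = \<pi> \<beta> (g x) + \<pi> \<beta> (sum g F)"
      using rep that(1) that(3) unfolding is_rep_def by blast
    then show ?case using insert by simp
  qed
  have fwd: "(\<chi> x. \<Theta> (axis x 1)) \<in> component U V \<pi>" if "\<Theta> \<in> hom_space U scl V \<pi>" for \<Theta>
  proof -
    have "\<Theta> (axis (\<beta> x) 1) = \<pi> \<beta> (\<Theta> (axis x 1))" if "\<beta> \<in> carrier U" for \<beta> x
      using \<open>\<Theta> \<in> _\<close> that sigma_axis[OF bij[OF that], of x]
      unfolding hom_space_def by (metis (mono_tags, lifting) mem_Collect_eq)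
    moreover have "\<Theta> (axis x 1) \<in> V" for x
      using that unfolding hom_space_def by blast
    ultimately show ?thesis by (simp add: component_def)
  qed
  have bwd: "ext \<theta> \<in> hom_space U scl V \<pi>" if th: "\<theta> \<in> component U V \<pi>" for \<theta>
  proof -
    have lin: "Vector_Spaces.linear (*s) scl (ext \<theta>)"
      by (intro Vector_Spaces.linear.intro module_hom.intro module_hom_axioms.intro
            vec.vector_space_axioms V.vector_space_axioms V.module_axioms vec.module_axioms)
        (auto simp: ext_def V.scale_left_distrib sum.distrib V.scale_sum_right)
    have mem: "\<theta> $ x \<in> V" for x using th by (simp add: component_def)
    have "range (ext \<theta>) \<subseteq> V"
      using mem subV by (auto simp: ext_def intro!: V.subspace_sum V.subspace_scale)
    moreover have "ext \<theta> (sigma \<beta> f) = \<pi> \<beta> (ext \<theta> f)" if b: "\<beta> \<in> carrier U" for \<beta> f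
    proof -
      have sc: "\<pi> \<beta> (scl r (\<theta> $ x)) = scl r (\<theta> $ \<beta> x)" for r x
      proof -
        have "\<pi> \<beta> (scl r (\<theta> $ x)) = scl r (\<pi> \<beta> (\<theta> $ x))"
          using rep b mem unfolding is_rep_def by blast
        then show ?thesis using th b by (simp add: component_def)
      qed
      have "ext \<theta> (sigma \<beta> f) = (\<Sum>x\<in>UNIV. scl (f $ inv_into UNIV \<beta> (\<beta> x)) (\<theta> $ \<beta> x))"
        unfolding ext_def sigma_def
        using sum.reindex_bij_betw[OF bij[OF b], of "\<lambda>x. scl (f $ inv_into UNIV \<beta> x) (\<theta> $ x)"]
        by simp
      also have "\<dots> = (\<Sum>x\<in>UNIV. \<pi> \<beta> (scl (f $ x) (\<theta> $ x)))"
        using bij[OF b] by (simp add: sc bij_is_inj)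
      also have "\<dots> = \<pi> \<beta> (ext \<theta> f)"
        unfolding ext_def using b mem subV by (intro pi_sum[symmetric]) (auto intro: V.subspace_scale)
      finally show ?thesis .
    qed
    ultimately show ?thesis using lin by (simp add: hom_space_def)
  qed
  show ?thesis
    by (rule bij_betw_byWitness[where f' = ext])
      (use left fwd bwd in \<open>auto simp: ext_axis vec_eq_iff\<close>)
qed

end

theory Submission
  imports Defs "HOL-Number_Theory.Residues"
begin

text \<open>
  The unitary group \<open>U\<close> consists of the multiplications by scalars \<open>\<zeta>\<close> of norm one
  (\<open>unitary_pair_carrier\<close>). Such a multiplication is, up to sign, \<open>\<rho>\<close> of the central element \<open>h\<close>
  of \<open>G\<close> with \<open>t = \<zeta>\<^sup>-\<^sup>1\<close>; hence it commutes with \<open>\<rho>\<close>, and every component is stable under \<open>G\<close>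
  (\<open>kernel_unitary_invariant\<close>, \<open>component_rep\<close>).

  For irreducibility, let \<open>W\<close> be a nonzero \<open>G\<close>-stable subspace of the space of equivariant functions
  \<open>\<theta> : M \<rightarrow> V\<close>. The generators act in three complementary ways. The \<open>u\<^sub>s\<close> are multiplication operators
  by the functions \<open>\<gamma>(s, \<cdot>)\<close>, and these functions separate the orbits of \<open>U\<close> on \<open>M\<close>; averaging over
  \<open>s\<close> therefore cuts a function of \<open>W\<close> down to a single orbit without leaving \<open>W\<close>
  (\<open>gamma_separates_orbits\<close>, \<open>restrict_orbit_in_W\<close>). The \<open>h\<^sub>t\<close> permute the nonzero points of \<open>M\<close>
  transitively, so what \<open>W\<close> contains on one nonzero orbit it contains on all of them; scalar \<open>t\<close> of
  norm one show that the values of \<open>W\<close> at a point form a \<open>U\<close>-stable subspace of the irreducible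
  \<open>V\<close>, hence all of \<open>V\<close> (\<open>evaluation_surjective\<close>). The Fourier transform \<open>w\<close> finally links the
  nonzero orbits with the origin, in both directions (\<open>nonzero_off_origin\<close>, \<open>values_attained\<close>).
  Together this puts every orbit restriction of every equivariant function into \<open>W\<close>, and an
  equivariant function is the sum of its orbit restrictions (\<open>W_eq_Comp\<close>).
\<close>

section \<open>Row vectors and matrices over a field\<close>

definition outer :: "'a::field^'m \<Rightarrow> 'a^'n \<Rightarrow> 'a^'n^'m" where
  "outer a b = (\<chi> i j. a $ i * b $ j)"

lemma vector_matrix_mult_outer:
  "x v* outer a b = (\<Sum>i\<in>UNIV. x $ i * a $ i) *s b"
  by (simp add: vec_eq_iff vector_matrix_mult_def outer_def sum_distrib_right mult.assoc)

lemma sum_axis: "(\<Sum>i\<in>UNIV. x $ i * axis j c $ i) = x $ j * (c :: 'a::field)"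
  by (simp add: axis_def if_distrib[of "\<lambda>c. _ * c"] cong: if_cong)

lemma matrix_mul_mat_left: "mat z ** A = (\<chi> i j. (z :: 'a::comm_ring_1) * A $ i $ j)"
  by (simp add: vec_eq_iff matrix_matrix_mult_def mat_def if_distrib[of "\<lambda>c. c * _"] cong: if_cong)

lemma matrix_mul_mat_right: "A ** mat z = (\<chi> i j. (z :: 'a::comm_ring_1) * A $ i $ j)"
  by (simp add: vec_eq_iff matrix_matrix_mult_def mat_def if_distrib[of "\<lambda>c. _ * c"]
      mult.commute cong: if_cong)

lemma mat_mult_mat: "mat z ** mat z' = (mat (z * z') :: 'a::comm_ring_1^'n::finite^'n)"
  unfolding matrix_mul_mat_left by (simp add: vec_eq_iff mat_def)

lemma vector_matrix_mult_mat: "x v* mat z = (z :: 'a::comm_ring_1) *s x"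
  by (simp add: vec_eq_iff vector_matrix_mult_def mat_def if_distrib[of "\<lambda>c. _ * c"]
      mult.commute cong: if_cong)

lemma matrix_inv_invertible:
  fixes A :: "'a::field^'n::finite^'n"
  assumes "invertible A"
  shows "A ** matrix_inv A = mat 1" "matrix_inv A ** A = mat 1"
  using someI_ex[OF assms[unfolded invertible_def]] by (auto simp: matrix_inv_def)

lemma matrix_inv_unique:
  fixes A B :: "'a::field^'n::finite^'n"
  assumes "A ** B = mat 1"
  shows "invertible A" "matrix_inv A = B"
proof -
  show inv: "invertible A" using assms by (auto simp: invertible_right_inverse)
  show "matrix_inv A = B"
    by (metis assms inv matrix_inv_invertible(2) matrix_mul_assoc matrix_mul_lid matrix_mul_rid)
qed

text \<open>
  A rank one perturbation of the identity does it: \<open>t = 1 + a (y - x)\<close>, with a column \<open>a\<close>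
  such that \<open>x a = 1\<close>, sends \<open>x\<close> to \<open>y\<close>, and it is invertible as soon as \<open>y a \<noteq> 0\<close>.
\<close>

lemma invertible_matrix_transitive:
  fixes x y :: "'a::field^'n::finite"
  assumes "x \<noteq> 0" "y \<noteq> 0"
  shows "\<exists>t. invertible t \<and> x v* t = y"
proof -
  let ?dot = "\<lambda>z a :: 'a^'n. \<Sum>i\<in>UNIV. z $ i * a $ i"
  have "\<exists>a. ?dot x a = 1 \<and> ?dot y a \<noteq> 0"
  proof (cases "\<exists>j. x $ j \<noteq> 0 \<and> y $ j \<noteq> 0")
    case True
    then obtain j where "x $ j \<noteq> 0" "y $ j \<noteq> 0" by blast
    then show ?thesis by (intro exI[of _ "axis j (1 / x $ j)"]) (simp add: sum_axis)
  next
    case False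
    obtain i j where "x $ i \<noteq> 0" "y $ j \<noteq> 0" using assms by (auto simp: vec_eq_iff)
    \<comment> \<open>Here \<open>x\<close> vanishes at \<open>j\<close> and \<open>y\<close> at \<open>i\<close>, so the two entries of \<open>a\<close> do not interact.\<close>
    then show ?thesis using False
      by (intro exI[of _ "axis i (1 / x $ i) + axis j 1"])
        (auto simp: sum_axis distrib_left sum.distrib)
  qed
  then obtain a where a: "?dot x a = 1" "?dot y a \<noteq> 0" by blast
  define t :: "'a^'n^'n" where "t = mat 1 + outer a (y - x)"
  have mult_t: "z v* t = z + ?dot z a *s (y - x)" for z
    by (simp add: t_def vector_matrix_mult_add_rdistrib vector_matrix_mult_outer)
  have "z = 0" if "transpose t *v z = 0" for z
  proof -
    have z: "z + ?dot z a *s (y - x) = 0" using that by (simp add: mult_t)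
    have dot_sub: "?dot (y - x) a = ?dot y a - ?dot x a"
      by (simp add: left_diff_distrib sum_subtractf)
    have "0 = ?dot (z + ?dot z a *s (y - x)) a" using z by simp
    also have "\<dots> = ?dot z a + ?dot z a * ?dot (y - x) a"
      by (simp only: vector_add_component vector_smult_component distrib_right sum.distrib
          mult.assoc sum_distrib_left)
    also have "\<dots> = ?dot z a * ?dot y a"
      by (simp only: dot_sub a) (simp add: algebra_simps)
    finally have "?dot z a = 0" using a by simp
    then show ?thesis using z by simp
  qed
  then have "\<exists>B. B ** transpose t = mat 1"
    by (simp add: matrix_left_invertible_ker)
  then have "invertible t"
    by (simp add: left_invertible_transpose invertible_right_inverse)
  moreover have "x v* t = y" by (simp add: mult_t a)
  ultimately show ?thesis by blast
qed

section \<open>The involution of a quadratic extension of finite fields\<close>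

text \<open>
  Counting shows \<open>K = k + k a\<close> for any \<open>a\<close> moved by the automorphism. Then \<open>a\<close> satisfies
  \<open>a\<^sup>2 = s + t a\<close> with \<open>s, t \<in> k\<close>, and its conjugate, being another root of the same quadratic
  polynomial, must be \<open>t - a\<close>; conjugating once more returns \<open>a\<close>.
\<close>

lemma quadratic_extension_bar_involution:
  fixes k :: "'a::{field,finite} set"
  assumes k: "is_subfield k" and q: "card k = q" "CARD('a) = q ^ 2"
    and bar: "nontrivial_automorphism_over k bar"
  shows "bar (bar x) = x"
proof -
  have bar_add: "bar (x + y) = bar x + bar y" and bar_mult: "bar (x * y) = bar x * bar y" for x y
    using bar by (auto simp: nontrivial_automorphism_over_def)
  have bar_k: "bar x = x" if "x \<in> k" for x
    using bar that by (auto simp: nontrivial_automorphism_over_def)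
  obtain a where a: "bar a \<noteq> a"
    using bar by (auto simp: nontrivial_automorphism_over_def fun_eq_iff)
  have add_k: "x + y \<in> k" and mult_k: "x * y \<in> k" and minus_k: "- x \<in> k"
    and inv_k: "inverse x \<in> k" if "x \<in> k" "y \<in> k" for x y
    using k that by (auto simp: is_subfield_def)
  have inj: "inj_on (\<lambda>(s, t). s + t * a) (k \<times> k)"
  proof (rule inj_onI, clarsimp)
    fix s t s' t' assume mem: "s \<in> k" "t \<in> k" "s' \<in> k" "t' \<in> k" and eq: "s + t * a = s' + t' * a"
    have "t = t'"
    proof (rule ccontr)
      assume "t \<noteq> t'"
      then have "a = (s' + - s) * inverse (t + - t')"
        using eq by (simp add: field_simps)
      then have "a \<in> k" using mem by (metis add_k mult_k minus_k inv_k)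
      then show False using a bar_k by blast
    qed
    then show "s = s' \<and> t = t'" using eq by simp
  qed
  have "card ((\<lambda>(s, t). s + t * a) ` (k \<times> k)) = CARD('a)"
    using q by (simp add: card_image[OF inj] card_cartesian_product power2_eq_square)
  then have "(\<lambda>(s, t). s + t * a) ` (k \<times> k) = UNIV"
    by (intro card_subset_eq) auto
  then have basis: "\<exists>s\<in>k. \<exists>t\<in>k. x = s + t * a" for x
  proof -
    have "x \<in> (\<lambda>(s, t). s + t * a) ` (k \<times> k)"
      using \<open>_ = UNIV\<close> by simp
    then show ?thesis by auto
  qed
  obtain s t where st: "s \<in> k" "t \<in> k" "a * a = s + t * a"
    using basis by blast
  have "bar a * bar a = bar (a * a)"
    by (simp add: bar_mult)
  also have "\<dots> = s + t * bar a"
    unfolding st(3) using st(1,2) by (simp add: bar_add bar_mult bar_k)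
  finally have "bar a * bar a = s + t * bar a" .
  then have "(bar a - a) * (bar a + a - t) = 0"
    using st(3) by (simp add: algebra_simps)
  then have sum_k: "bar a + a = t" using a by simp
  have "bar (bar a + a) = bar t"
    by (simp only: sum_k)
  then have "bar (bar a) + bar a = t"
    using st(2) by (simp add: bar_add bar_k)
  then have "bar (bar a) = a" using sum_k by (metis add.commute add_right_cancel)
  moreover obtain u v where "u \<in> k" "v \<in> k" "x = u + v * a"
    using basis by blast
  ultimately show ?thesis by (simp add: bar_add bar_mult bar_k)
qed

text \<open>
  The characteristic divides the order of the field, so it cannot divide 2 as well.
\<close>

lemma two_neq_zero_if_odd_card:
  assumes "odd (CARD('a::{field,finite}))"
  shows "(2::'a) \<noteq> 0"
proof
  assume "(2::'a) = 0"
  then have "CHAR('a) dvd 2"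
    using of_nat_eq_0_iff_char_dvd[of 2, where ?'a = 'a] by simp
  then have "CHAR('a) dvd gcd 2 (CARD('a))"
    using CHAR_dvd_CARD[where ?'a = 'a] by simp
  moreover have "gcd 2 (CARD('a)) = 1"
    using assms by (simp add: coprime_left_2_iff_odd)
  ultimately have "of_nat 1 = (0::'a)"
    by (simp only: of_nat_eq_0_iff_char_dvd)
  then show False by simp
qed

locale conjugation_character =
  fixes bar :: "'a::{field,finite} \<Rightarrow> 'a" and \<psi> :: "'a \<Rightarrow> complex"
  assumes bar_add: "bar (x + y) = bar x + bar y"
    and bar_mult: "bar (x * y) = bar x * bar y"
    and bar_bar [simp]: "bar (bar x) = x"
    and two_neq_zero: "(2::'a) \<noteq> 0"
    and char: "nontrivial_additive_character \<psi>"
    and \<psi>_bar: "\<psi> (bar x) = \<psi> x"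
begin

lemma bar_0 [simp]: "bar 0 = 0"
  using bar_add[of 0 0] by (metis add_0 add_cancel_right_left)

lemma bar_eq_0_iff [simp]: "bar x = 0 \<longleftrightarrow> x = 0"
  by (metis bar_0 bar_bar)

lemma bar_1 [simp]: "bar 1 = 1"
  using bar_mult[of 1 1] by (metis bar_eq_0_iff mult_cancel_left2 mult_1 one_neq_zero)

lemma bar_minus: "bar (- x) = - bar x"
  using bar_add[of x "- x"] by (simp add: eq_neg_iff_add_eq_0 add.commute)

lemma bar_sum: "bar (sum f A) = (\<Sum>x\<in>A. bar (f x))"
  by (induction A rule: infinite_finite_induct) (auto simp: bar_add)

lemma \<psi>_0: "\<psi> 0 = 1" and \<psi>_add: "\<psi> (x + y) = \<psi> x * \<psi> y"
  using char by (auto simp: nontrivial_additive_character_def)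

text \<open>
  By invariance under conjugation both halves contribute the same value. This lets \<open>\<gamma>\<close>, which
  evaluates \<open>\<psi>\<close> at halves of elements of the fixed field only, detect elements of all of \<open>K\<close>.
\<close>

lemma \<psi>_half_trace: "\<psi> (inverse 2 * (w + bar w)) = \<psi> w"
proof -
  have "bar 2 = 2" using bar_add[of 1 1] by simp
  then have "2 * bar (inverse 2) = 1"
    using bar_mult[of 2 "inverse 2"] two_neq_zero by simp
  then have "bar (inverse 2) = inverse 2"
    by (metis inverse_unique)
  then have "\<psi> (inverse 2 * (w + bar w)) = \<psi> (inverse 2 * w) * \<psi> (bar (inverse 2 * w))"
    by (simp only: bar_mult distrib_left \<psi>_add)
  also have "\<dots> = \<psi> (inverse 2 * w + inverse 2 * w)"
    by (simp only: \<psi>_bar \<psi>_add)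
  also have "inverse 2 * w + inverse 2 * w = w"
    using two_neq_zero by (simp flip: distrib_right mult_2_right)
  finally show ?thesis .
qed

lemma \<psi>_multiples_trivial:
  assumes "\<And>t. \<psi> (t * z) = 1"
  shows "z = 0"
proof (rule ccontr)
  assume "z \<noteq> 0"
  obtain x where "\<psi> x \<noteq> 1"
    using char by (auto simp: nontrivial_additive_character_def)
  then show False
    using assms[of "x / z"] \<open>z \<noteq> 0\<close> by simp
qed

section \<open>Hermitian matrices separate the orbits of the unitary group\<close>

definition norm_one :: "'a set" where
  "norm_one = {\<zeta>. \<zeta> * bar \<zeta> = 1}"

lemma norm_one_1 [simp]: "1 \<in> norm_one"
  by (simp add: norm_one_def)

lemma norm_one_mult: "\<zeta> \<in> norm_one \<Longrightarrow> \<mu> \<in> norm_one \<Longrightarrow> \<zeta> * \<mu> \<in> norm_one"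
  by (simp add: norm_one_def bar_mult) (metis mult.assoc mult.commute mult_1)

lemma norm_one_neq_0: "\<zeta> \<in> norm_one \<Longrightarrow> \<zeta> \<noteq> 0"
  by (auto simp: norm_one_def)

lemma norm_one_bar: "\<zeta> \<in> norm_one \<Longrightarrow> bar \<zeta> \<in> norm_one"
  by (simp add: norm_one_def mult.commute)

definition orbit :: "'a^'n \<Rightarrow> ('a^'n) set" where
  "orbit x = (\<lambda>\<zeta>. \<zeta> *s x) ` norm_one"

lemma orbit_refl [simp]: "x \<in> orbit x"
  unfolding orbit_def by (rule image_eqI[of _ _ 1]) auto

lemma orbit_sym: "y \<in> orbit x \<Longrightarrow> x \<in> orbit y"
proof -
  assume "y \<in> orbit x"
  then obtain \<zeta> where "\<zeta> \<in> norm_one" "y = \<zeta> *s x" by (auto simp: orbit_def)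
  then have "x = bar \<zeta> *s y" "bar \<zeta> \<in> norm_one"
    by (auto simp: norm_one_bar vector_smult_assoc norm_one_def mult.commute)
  then show ?thesis by (auto simp: orbit_def)
qed

lemma orbit_trans: "y \<in> orbit x \<Longrightarrow> z \<in> orbit y \<Longrightarrow> z \<in> orbit x"
  by (auto simp: orbit_def vector_smult_assoc intro!: image_eqI norm_one_mult)

lemma orbit_eq: "y \<in> orbit x \<Longrightarrow> orbit y = orbit x"
  using orbit_sym orbit_trans by blast

lemma card_orbit_neq_0 [simp]: "card (orbit (x :: 'a^'n::finite)) \<noteq> 0"
  using orbit_refl[of x] by (metis card_0_eq empty_iff finite_code)

text \<open>
  The Hermitian matrix \<open>t E\<^sub>i\<^sub>j + bar t E\<^sub>j\<^sub>i\<close> supported on one pair of positions, or on the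
  diagonal when \<open>i = j\<close>, where the two summands add up to the trace of \<open>t\<close>.
\<close>

definition elem_herm :: "'n::finite \<Rightarrow> 'n \<Rightarrow> 'a \<Rightarrow> 'a^'n^'n" where
  "elem_herm i j t = outer (axis i 1) (axis j t) + outer (axis j 1) (axis i (bar t))"

lemma star_elem_herm: "star bar (elem_herm i j t) = elem_herm i j t"
  by (auto simp: elem_herm_def star_def outer_def axis_def vec_eq_iff bar_add bar_mult)

lemma herm_form_elem_herm:
  fixes x :: "'a^'n::finite"
  shows "herm_form bar (x v* elem_herm i j t) x
     = t * (x $ i * bar (x $ j)) + bar (t * (x $ i * bar (x $ j)))"
proof -
  have ax: "(\<Sum>p\<in>UNIV. axis j c $ p * bar (x $ p)) = c * bar (x $ j)" for j :: 'n and c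
    using sum_axis[of "\<chi> p. bar (x $ p)" j c] by (simp add: mult.commute)
  have "herm_form bar (x v* elem_herm i j t) x
      = (\<Sum>p\<in>UNIV. x $ i * (axis j t $ p * bar (x $ p)) + x $ j * (axis i (bar t) $ p * bar (x $ p)))"
    unfolding herm_form_def elem_herm_def vector_matrix_mult_add_rdistrib
    by (simp add: vector_matrix_mult_outer sum_axis ring_distribs mult.assoc)
  also have "\<dots> = x $ i * (t * bar (x $ j)) + x $ j * (bar t * bar (x $ i))"
    by (simp add: sum.distrib ax flip: sum_distrib_left)
  finally show ?thesis by (simp add: bar_mult mult_ac)
qed

lemma gamma_elem_herm:
  "weil_gamma bar \<psi> (elem_herm i j t) x = \<psi> (t * (x $ i * bar (x $ j)))"
  unfolding weil_gamma_def herm_form_elem_herm by (rule \<psi>_half_trace)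

lemma gamma_0: "weil_gamma bar \<psi> 0 x = 1"
  by (simp add: weil_gamma_def herm_form_def \<psi>_0)

lemma gamma_add: "weil_gamma bar \<psi> (s + s') x = weil_gamma bar \<psi> s x * weil_gamma bar \<psi> s' x"
  by (simp add: weil_gamma_def herm_form_def vector_matrix_mult_add_rdistrib ring_distribs
      sum.distrib \<psi>_add)

lemma gamma_uminus: "weil_gamma bar \<psi> s x * weil_gamma bar \<psi> (- s) x = 1"
  using gamma_add[of s "- s" x] by (simp add: gamma_0)

lemma herm_form_scale:
  assumes "\<zeta> \<in> norm_one"
  shows "herm_form bar (\<zeta> *s x) (\<zeta> *s y) = herm_form bar x y"
proof -
  have "\<zeta> * a * bar (\<zeta> * b) = (\<zeta> * bar \<zeta>) * (a * bar b)" for a b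
    by (simp add: bar_mult mult_ac)
  then have "\<zeta> * a * bar (\<zeta> * b) = a * bar b" for a b
    using assms by (simp only: norm_one_def mem_Collect_eq mult_1)
  then show ?thesis
    by (simp only: herm_form_def vector_smult_component)
qed

lemma gamma_scale: "\<zeta> \<in> norm_one \<Longrightarrow> weil_gamma bar \<psi> s (\<zeta> *s x) = weil_gamma bar \<psi> s x"
  by (simp add: weil_gamma_def scalar_vector_matrix_assoc herm_form_scale)

text \<open>
  Testing against \<open>elem_herm i j t\<close> for all \<open>t\<close> recovers, since \<open>\<psi>\<close> is nontrivial, every product
  \<open>x\<^sub>i bar x\<^sub>j\<close>, that is, the rank one Hermitian matrix of \<open>x\<close>. This matrix determines \<open>x\<close> up to a
  scalar of norm one.
\<close>

lemma gamma_separates_orbits: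
  fixes x y :: "'a^'n::finite"
  shows "(\<forall>s. star bar s = s \<longrightarrow> weil_gamma bar \<psi> s y = weil_gamma bar \<psi> s x)
           \<longleftrightarrow> y \<in> orbit x"
proof
  assume eq: "\<forall>s. star bar s = s \<longrightarrow> weil_gamma bar \<psi> s y = weil_gamma bar \<psi> s x"
  have entries: "y $ i * bar (y $ j) = x $ i * bar (x $ j)" for i j
  proof -
    have "\<psi> (t * (y $ i * bar (y $ j) - x $ i * bar (x $ j))) = 1" for t
    proof -
      let ?X = "t * (x $ i * bar (x $ j))" and ?Y = "t * (y $ i * bar (y $ j))"
      have "\<psi> ?Y = \<psi> ?X"
        using eq star_elem_herm[of i j t] by (metis gamma_elem_herm)
      moreover have "\<psi> (?Y - ?X) * \<psi> ?X = \<psi> ?Y" "\<psi> ?X * \<psi> (- ?X) = 1"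
        by (simp_all add: \<psi>_0 flip: \<psi>_add)
      ultimately have "\<psi> (?Y - ?X) * \<psi> ?X = 1 * \<psi> ?X" "\<psi> ?X \<noteq> 0"
        by auto
      then have "\<psi> (?Y - ?X) = 1"
        by (simp only: mult_cancel_right simp_thms)
      then show ?thesis
        by (simp only: right_diff_distrib)
    qed
    then show ?thesis
      using \<psi>_multiples_trivial[of "y $ i * bar (y $ j) - x $ i * bar (x $ j)"] by simp
  qed
  show "y \<in> orbit x"
  proof (cases "x = 0")
    case True
    then have "y = 0" using entries by (simp add: vec_eq_iff) (metis bar_eq_0_iff)
    then show ?thesis using True by simp
  next
    case False
    then obtain j where x: "x $ j \<noteq> 0" by (auto simp: vec_eq_iff)
    then have y: "y $ j \<noteq> 0" using entries[of j j] by auto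
    define \<zeta> where "\<zeta> = bar (x $ j) / bar (y $ j)"
    have "\<zeta> = y $ j / x $ j"
      using x y entries[of j j] by (simp add: \<zeta>_def field_simps)
    then have "bar \<zeta> * bar (x $ j) = bar (y $ j)"
      using x by (simp flip: bar_mult)
    then have "\<zeta> \<in> norm_one"
      using x y by (simp add: norm_one_def \<zeta>_def field_simps)
    moreover have "y = \<zeta> *s x"
      using y entries[of _ j] by (simp add: \<zeta>_def vec_eq_iff field_simps)
    ultimately show ?thesis by (auto simp: orbit_def)
  qed
qed (auto simp: gamma_scale orbit_def)

text \<open>
  A map that commutes with all of \<open>A\<^sub>n\<close> is determined by its value at one basis vector \<open>e\<close>, because
  \<open>x = e u\<close> for a rank one matrix \<open>u\<close>, and the image of \<open>x\<close> is then a multiple of \<open>x\<close>. Since \<open>\<gamma>\<close>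
  separates the orbits of \<open>norm_one\<close>, invariance of \<open>\<gamma>\<close> forces the multiplier to have norm one.
\<close>

lemma unitary_pair_carrier:
  "carrier (unitary_pair bar \<psi> :: ('a^'n::finite \<Rightarrow> 'a^'n) monoid) = (*s) ` norm_one"
proof (intro equalityI subsetI)
  fix \<beta> :: "'a^'n \<Rightarrow> 'a^'n"
  assume "\<beta> \<in> carrier (unitary_pair bar \<psi>)"
  then have lin: "\<beta> (x v* u) = \<beta> x v* u"
    and inv: "star bar b = b \<Longrightarrow> weil_gamma bar \<psi> b (\<beta> x) = weil_gamma bar \<psi> b x"
    for x b and u :: "'a^'n^'n"
    by (auto simp: unitary_pair_def)
  obtain i :: 'n where True by simp
  let ?e = "axis i 1 :: 'a^'n"
  define \<zeta> where "\<zeta> = \<beta> ?e $ i"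
  have scal: "\<beta> x = \<zeta> *s x" for x
  proof -
    have "?e v* outer ?e x = x"
      by (simp add: vector_matrix_mult_outer sum_axis)
    then show ?thesis
      using lin[of ?e "outer ?e x"] by (simp add: vector_matrix_mult_outer sum_axis \<zeta>_def)
  qed
  obtain \<mu> where "\<mu> \<in> norm_one" "\<zeta> *s ?e = \<mu> *s ?e"
    using gamma_separates_orbits[of "\<beta> ?e" ?e] inv scal by (auto simp: orbit_def)
  then have "\<zeta> \<in> norm_one"
    using arg_cong[of "\<zeta> *s ?e" "\<mu> *s ?e" "\<lambda>v. v $ i"] by simp
  then show "\<beta> \<in> (*s) ` norm_one" using scal by auto
next
  fix \<beta> :: "'a^'n \<Rightarrow> 'a^'n"
  assume "\<beta> \<in> (*s) ` norm_one"
  then obtain \<zeta> where \<zeta>: "\<zeta> \<in> norm_one" "\<beta> = (*s) \<zeta>" by blast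
  have "bij ((*s) \<zeta> :: 'a^'n \<Rightarrow> 'a^'n)"
    using norm_one_neq_0[OF \<zeta>(1)]
    by (intro bij_betw_byWitness[where f' = "(*s) (inverse \<zeta>)"]) (auto simp: vector_smult_assoc)
  then show "\<beta> \<in> carrier (unitary_pair bar \<psi>)"
    using \<zeta> by (auto simp: unitary_pair_def gamma_scale scalar_vector_matrix_assoc vector_add_ldistrib)
qed

text \<open>
  For fixed \<open>x\<close> and \<open>y\<close> the summand is a character of the additive group of Hermitian matrices, and
  by \<open>gamma_separates_orbits\<close> it is trivial exactly when \<open>y\<close> lies in the orbit of \<open>x\<close>.
\<close>

lemma gamma_orthogonality:
  fixes x y :: "'a^'n::finite"
  shows "(\<Sum>s | star bar s = s. weil_gamma bar \<psi> (- s) x * weil_gamma bar \<psi> s y)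
    = (if y \<in> orbit x then of_nat (card {s :: 'a^'n^'n. star bar s = s}) else 0)"
proof (cases "y \<in> orbit x")
  case True
  then have "weil_gamma bar \<psi> s y = weil_gamma bar \<psi> s x" for s
    by (auto simp: gamma_scale orbit_def)
  then have "weil_gamma bar \<psi> (- s) x * weil_gamma bar \<psi> s y = 1" for s
    using gamma_uminus[of s x] by (simp add: mult.commute)
  then show ?thesis using True by simp
next
  case False
  let ?H = "{s :: 'a^'n^'n. star bar s = s}"
  let ?f = "\<lambda>s. weil_gamma bar \<psi> (- s) x * weil_gamma bar \<psi> s y"
  have f_add: "?f (s + s') = ?f s * ?f s'" for s s'
    using gamma_add[of "- s" "- s'" x] by (simp add: gamma_add)
  \<comment> \<open>The translate by an \<open>s0\<close> on which the character is nontrivial annihilates the sum.\<close>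
  obtain s0 where s0: "star bar s0 = s0" "weil_gamma bar \<psi> s0 y \<noteq> weil_gamma bar \<psi> s0 x"
    using False gamma_separates_orbits[of y x] by blast
  have "?f s0 \<noteq> 1"
    using s0(2) gamma_uminus[of s0 x] by (metis mult.commute mult_left_cancel mult_zero_right zero_neq_one)
  have "(\<Sum>s\<in>?H. ?f s) = (\<Sum>s\<in>?H. ?f (s0 + s))"
  proof (rule sum.reindex_bij_witness[where i = "\<lambda>s. s0 + s" and j = "\<lambda>s. s - s0"])
  qed (use s0(1) in \<open>auto simp: star_def vec_eq_iff bar_add bar_minus diff_conv_add_uminus
         simp del: add_uminus_conv_diff\<close>)
  also have "\<dots> = ?f s0 * (\<Sum>s\<in>?H. ?f s)"
    by (simp only: f_add sum_distrib_left)
  finally show ?thesis using False \<open>?f s0 \<noteq> 1\<close> by simp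
qed

end

section \<open>Generators of the group\<close>

context conjugation_character
begin

lemma star_mult: "star bar (A ** B) = star bar B ** star bar (A :: 'a^'n::finite^'n)"
  by (simp add: star_def vec_eq_iff matrix_matrix_mult_def bar_sum bar_mult mult.commute)

lemma star_mat: "star bar (mat z) = mat (bar z)"
  by (simp add: star_def vec_eq_iff mat_def)

lemma star_0: "star bar 0 = 0"
  by (simp add: star_def vec_eq_iff)

lemma star_uminus: "star bar (- A) = - star bar A"
  by (simp add: star_def vec_eq_iff bar_minus)

lemma u_elt_in_SLstar:
  "star bar s = s \<Longrightarrow> u_elt s \<in> carrier (SLstar bar :: ('a, 'n::finite) block monoid)"
  by (simp add: SLstar_def u_elt_def star_mat star_0)

lemma w_elt_in_SLstar: "w_elt \<in> carrier (SLstar bar :: ('a, 'n::finite) block monoid)"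
  by (simp add: SLstar_def w_elt_def star_mat star_0 star_uminus)

lemma h_elt_in_SLstar:
  assumes "invertible t"
  shows "h_elt bar t \<in> carrier (SLstar bar :: ('a, 'n::finite) block monoid)"
proof -
  have "star bar (matrix_inv t) ** star bar t = mat 1"
    using assms by (simp add: matrix_inv_invertible(1) star_mat flip: star_mult)
  then have *: "star bar t ** star bar (matrix_inv t) = mat 1"
    by (simp add: matrix_left_right_inverse)
  have "star bar (star bar (matrix_inv t)) = matrix_inv t"
    by (simp add: star_def vec_eq_iff)
  then show ?thesis
    using assms * by (simp add: SLstar_def h_elt_def matrix_inv_unique[OF *] star_0 matrix_inv_invertible(1))
qed

lemma h_elt_scalar:
  assumes "\<zeta> \<in> norm_one"
  shows "h_elt bar (mat \<zeta>) = (mat \<zeta>, 0, 0, mat \<zeta> :: 'a^'n::finite^'n)"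
proof -
  have "star bar (mat \<zeta>) ** mat \<zeta> = (mat 1 :: 'a^'n^'n)"
    using assms by (simp add: star_mat mat_mult_mat norm_one_def mult.commute)
  then show ?thesis by (simp add: h_elt_def matrix_inv_unique(2))
qed

lemma invertible_mat_norm_one:
  assumes "\<zeta> \<in> norm_one"
  shows "invertible (mat \<zeta> :: 'a^'n::finite^'n)"
proof (rule matrix_inv_unique(1))
  show "mat \<zeta> ** mat (bar \<zeta>) = (mat 1 :: 'a^'n^'n)"
    using assms by (simp add: mat_mult_mat norm_one_def)
qed

text \<open>
  For a scalar \<open>\<zeta>\<close> of norm one both diagonal blocks of \<open>h\<close> are \<open>\<zeta>\<close>, so \<open>h\<close> is a scalar matrix.
\<close>

lemma h_elt_scalar_central:
  assumes "\<zeta> \<in> norm_one"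
  shows "block_mult (h_elt bar (mat \<zeta>)) g = block_mult g (h_elt bar (mat \<zeta>))"
  by (cases g) (simp add: h_elt_scalar[OF assms] matrix_mul_mat_left matrix_mul_mat_right)

end

section \<open>Kernels of the Weil representation\<close>

locale weil_representation = conjugation_character bar \<psi>
  for bar :: "'a::{field,finite} \<Rightarrow> 'a" and \<psi> :: "'a \<Rightarrow> complex" +
  fixes sgn' :: "'a \<Rightarrow> complex" and c :: complex
    and \<rho> :: "('a, 'n::finite) block \<Rightarrow> complex^('a^'n) \<Rightarrow> complex^('a^'n)"
  assumes sgn: "nontrivial_quadratic_character sgn'"
    and c_neq_0: "c \<noteq> 0"
    and weil: "is_weil_rep bar \<psi> sgn' c \<rho>"
begin

abbreviation kernel :: "('a, 'n) block \<Rightarrow> complex^('a^'n)^('a^'n)" where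
  "kernel g \<equiv> matrix (\<rho> g)"

lemma rho_rep: "is_rep (SLstar bar) (*s) UNIV \<rho>"
  using weil by (simp add: is_weil_rep_def)

lemma sgn_det_square:
  assumes "invertible t"
  shows "sgn' (det t) * sgn' (det t) = 1"
  using assms sgn unfolding invertible_det_nz nontrivial_quadratic_character_def
  by (simp add: power2_eq_square)

lemma kernel_u:
  assumes "star bar s = s"
  shows "kernel (u_elt s) $ x $ y = (if y = x then weil_gamma bar \<psi> s x else 0)"
  using weil assms by (simp add: matrix_def is_weil_rep_def) (simp add: axis_def)

lemma kernel_h:
  assumes "invertible t"
  shows "kernel (h_elt bar t) $ x $ y = (if y = x v* t then sgn' (det t) else 0)"
proof -
  have "x = y v* matrix_inv t \<longleftrightarrow> y = x v* t"
    using assms by (metis matrix_inv_invertible(2) matrix_inv_invertible(1) vector_matrix_mul_rid vector_matrix_mul_assoc)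
  moreover have "\<rho> (h_elt bar t) (axis y 1) = sgn' (det t) *s axis (y v* matrix_inv t) 1"
    using weil assms by (simp add: is_weil_rep_def)
  ultimately show ?thesis
    by (simp add: matrix_def axis_def)
qed

lemma kernel_w: "kernel w_elt $ x $ y = c * weil_chi bar \<psi> y x"
proof -
  have "(\<Sum>b\<in>UNIV. weil_chi bar \<psi> y b *s axis b 1) $ x = weil_chi bar \<psi> y x"
    by (simp add: axis_def if_distrib[of "\<lambda>c. _ * c"] cong: if_cong)
  then show ?thesis
    using weil by (simp add: matrix_def is_weil_rep_def)
qed

lemma rho_linear:
  assumes "g \<in> carrier (SLstar bar)"
  shows "Vector_Spaces.linear (*s) (*s) (\<rho> g)"
proof -
  have "\<rho> g (v + w) = \<rho> g v + \<rho> g w" "\<rho> g (r *s v) = r *s \<rho> g v" for v w r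
    using rho_rep assms unfolding is_rep_def by blast+
  then show ?thesis
    by (intro Vector_Spaces.linear.intro module_hom.intro module_hom_axioms.intro
            vec.vector_space_axioms vec.module_axioms) auto
qed

lemma kernel_mult:
  assumes "g \<in> carrier (SLstar bar)" "h \<in> carrier (SLstar bar)"
  shows "kernel (g \<otimes>\<^bsub>SLstar bar\<^esub> h) = kernel g ** kernel h"
proof -
  have "\<rho> (g \<otimes>\<^bsub>SLstar bar\<^esub> h) = \<rho> g \<circ> \<rho> h"
    using rho_rep assms by (auto simp: is_rep_def)
  then show ?thesis
    using matrix_compose_gen[OF rho_linear rho_linear] assms by simp
qed

lemma kernel_one: "kernel \<one>\<^bsub>SLstar bar\<^esub> = mat 1"
proof -
  have "\<rho> \<one>\<^bsub>SLstar bar\<^esub> = id"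
    using rho_rep by (auto simp: is_rep_def)
  then show ?thesis by (simp add: matrix_id_mat_1)
qed

text \<open>
  Up to the sign \<open>\<alpha>\<close>, the action of a scalar \<open>\<zeta>\<close> of norm one on functions is \<open>\<rho>\<close> of the central
  element \<open>h\<close> with \<open>t = \<zeta>\<^sup>-\<^sup>1\<close>, which commutes with all of \<open>\<rho>\<close>. For the kernels this means invariance
  under the diagonal action of the unitary group.
\<close>

lemma kernel_unitary_invariant:
  assumes g: "g \<in> carrier (SLstar bar)" and z: "\<zeta> \<in> norm_one"
  shows "kernel g $ (\<zeta> *s x) $ (\<zeta> *s y) = kernel g $ x $ y"
proof -
  define h :: "('a, 'n) block" where "h = h_elt bar (mat \<zeta>)"
  note inv = invertible_mat_norm_one[OF z, where ?'n = 'n]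
  have h: "h \<in> carrier (SLstar bar)"
    unfolding h_def by (intro h_elt_in_SLstar inv)
  define e where "e = sgn' (det (mat \<zeta> :: 'a^'n^'n))"
  have "e \<noteq> 0" using sgn_det_square[OF inv] by (auto simp: e_def)
  have K: "kernel h $ x $ y = (if y = \<zeta> *s x then e else 0)" for x y
    by (simp add: h_def kernel_h[OF inv] vector_matrix_mult_mat e_def)
  have "\<zeta> *s y = \<zeta> *s y' \<longleftrightarrow> y' = y" for y y' :: "'a^'n"
    using norm_one_neq_0[OF z] by auto
  then have "(kernel g ** kernel h) $ x $ (\<zeta> *s y) = kernel g $ x $ y * e"
    by (simp add: matrix_matrix_mult_def K if_distrib[of "\<lambda>c. _ * c"] cong: if_cong)
  moreover have "(kernel h ** kernel g) $ x $ (\<zeta> *s y) = e * kernel g $ (\<zeta> *s x) $ (\<zeta> *s y)"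
    by (simp add: matrix_matrix_mult_def K if_distrib[of "\<lambda>c. c * _"] cong: if_cong)
  moreover have "g \<otimes>\<^bsub>SLstar bar\<^esub> h = h \<otimes>\<^bsub>SLstar bar\<^esub> g"
    using h_elt_scalar_central[OF z, of g] by (simp add: SLstar_def h_def)
  ultimately show ?thesis
    using kernel_mult[OF g h] kernel_mult[OF h g] \<open>e \<noteq> 0\<close> by simp
qed

end

section \<open>The components as representations\<close>

lemma vector_space_pointwise_scale:
  assumes "vector_space scl"
  shows "vector_space (pointwise_scale scl)"
proof -
  interpret vector_space scl by (rule assms)
  show ?thesis
    by unfold_locales (simp_all add: pointwise_scale_def vec_eq_iff scale_right_distrib scale_left_distrib)
qed

locale weil_component = weil_representation bar \<psi> sgn' c \<rho>
  for bar :: "'a::{field,finite} \<Rightarrow> 'a" and \<psi> sgn' :: "'a \<Rightarrow> complex" and c :: complex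
    and \<rho> :: "('a, 'n::finite) block \<Rightarrow> complex^('a^'n) \<Rightarrow> complex^('a^'n)" +
  fixes scl :: "complex \<Rightarrow> 'v::ab_group_add \<Rightarrow> 'v" and V :: "'v set"
    and \<pi> :: "('a^'n \<Rightarrow> 'a^'n) \<Rightarrow> 'v \<Rightarrow> 'v"
  assumes irrep: "is_irrep (unitary_pair bar \<psi>) scl V \<pi>"
begin

abbreviation Comp :: "('v^('a^'n)) set" where
  "Comp \<equiv> component (unitary_pair bar \<psi>) V \<pi>"

abbreviation act :: "('a, 'n) block \<Rightarrow> 'v^('a^'n) \<Rightarrow> 'v^('a^'n)" where
  "act \<equiv> rho_hat \<rho> scl"

lemma \<pi>_rep: "is_rep (unitary_pair bar \<psi>) scl V \<pi>"
  using irrep by (simp add: is_irrep_def)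

sublocale V: vector_space scl
  using \<pi>_rep by (simp add: is_rep_def)

sublocale F: vector_space "pointwise_scale scl :: complex \<Rightarrow> 'v^('a^'n) \<Rightarrow> 'v^('a^'n)"
  by (rule vector_space_pointwise_scale) (rule V.vector_space_axioms)

lemma pointwise_scale_nth [simp]: "pointwise_scale scl r \<theta> $ x = scl r (\<theta> $ x)"
  by (simp add: pointwise_scale_def)

lemma subspace_V: "V.subspace V"
  using \<pi>_rep by (simp add: is_rep_def)

lemma scalar_in_unitary_pair:
  "\<zeta> \<in> norm_one \<Longrightarrow> (*s) \<zeta> \<in> carrier (unitary_pair bar \<psi> :: ('a^'n \<Rightarrow> 'a^'n) monoid)"
  by (simp add: unitary_pair_carrier)

lemma
  assumes "\<zeta> \<in> norm_one"
  shows \<pi>_closed: "v \<in> V \<Longrightarrow> \<pi> ((*s) \<zeta>) v \<in> V"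
    and \<pi>_add: "v \<in> V \<Longrightarrow> w \<in> V \<Longrightarrow> \<pi> ((*s) \<zeta>) (v + w) = \<pi> ((*s) \<zeta>) v + \<pi> ((*s) \<zeta>) w"
    and \<pi>_scale: "v \<in> V \<Longrightarrow> \<pi> ((*s) \<zeta>) (scl r v) = scl r (\<pi> ((*s) \<zeta>) v)"
  using \<pi>_rep scalar_in_unitary_pair[OF assms] unfolding is_rep_def by blast+

lemma \<pi>_one: "v \<in> V \<Longrightarrow> \<pi> ((*s) 1) v = v"
proof -
  have "((*s) 1 :: 'a^'n \<Rightarrow> 'a^'n) = \<one>\<^bsub>unitary_pair bar \<psi>\<^esub>"
    by (auto simp: unitary_pair_def)
  then show "v \<in> V \<Longrightarrow> ?thesis"
    using \<pi>_rep unfolding is_rep_def by metis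
qed

lemma \<pi>_mult:
  assumes "\<zeta> \<in> norm_one" "\<mu> \<in> norm_one" "v \<in> V"
  shows "\<pi> ((*s) (\<zeta> * \<mu>)) v = \<pi> ((*s) \<zeta>) (\<pi> ((*s) \<mu>) v)"
proof -
  have "((*s) (\<zeta> * \<mu>) :: 'a^'n \<Rightarrow> 'a^'n) = (*s) \<zeta> \<otimes>\<^bsub>unitary_pair bar \<psi>\<^esub> (*s) \<mu>"
    by (auto simp: unitary_pair_def vector_smult_assoc)
  then show ?thesis
    using \<pi>_rep scalar_in_unitary_pair assms unfolding is_rep_def by metis
qed

lemma \<pi>_0: "\<zeta> \<in> norm_one \<Longrightarrow> \<pi> ((*s) \<zeta>) 0 = 0"
  using \<pi>_scale[of \<zeta> 0 0] V.subspace_0[OF subspace_V] by simp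

lemma \<pi>_sum:
  assumes "\<zeta> \<in> norm_one" "\<And>x. x \<in> A \<Longrightarrow> f x \<in> V"
  shows "\<pi> ((*s) \<zeta>) (sum f A) = (\<Sum>x\<in>A. \<pi> ((*s) \<zeta>) (f x))"
  using assms(2)
proof (induction A rule: infinite_finite_induct)
  case (insert x A)
  then show ?case
    using assms(1) by (simp add: \<pi>_add V.subspace_sum[OF subspace_V])
qed (use assms in \<open>auto simp: \<pi>_0\<close>)

lemma V_irreducible:
  assumes "V.subspace S" "S \<subseteq> V" "S \<noteq> {0}"
    and "\<And>\<zeta> v. \<zeta> \<in> norm_one \<Longrightarrow> v \<in> S \<Longrightarrow> \<pi> ((*s) \<zeta>) v \<in> S"
  shows "S = V"
proof -
  have "\<forall>\<beta>\<in>carrier (unitary_pair bar \<psi>). \<forall>v\<in>S. \<pi> \<beta> v \<in> S"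
    using assms(4) by (auto simp: unitary_pair_carrier)
  then show ?thesis using irrep assms(1-3) unfolding is_irrep_def by blast
qed

lemma component_iff:
  "\<theta> \<in> Comp \<longleftrightarrow> (\<forall>x. \<theta> $ x \<in> V) \<and> (\<forall>\<zeta>\<in>norm_one. \<forall>x. \<theta> $ (\<zeta> *s x) = \<pi> ((*s) \<zeta>) (\<theta> $ x))"
  by (simp add: component_def unitary_pair_carrier)

lemma subspace_Comp: "F.subspace Comp"
  unfolding F.subspace_def using subspace_V
  by (auto simp: component_iff \<pi>_0 \<pi>_add \<pi>_scale V.subspace_0 V.subspace_add V.subspace_scale)

lemma act_closed:
  assumes g: "g \<in> carrier (SLstar bar)" and th: "\<theta> \<in> Comp"
  shows "act g \<theta> \<in> Comp"
proof -
  have V: "\<theta> $ x \<in> V" for x using th by (simp add: component_iff)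
  have "act g \<theta> $ (\<zeta> *s x) = \<pi> ((*s) \<zeta>) (act g \<theta> $ x)" if z: "\<zeta> \<in> norm_one" for \<zeta> x
  proof -
    have bij: "bij ((*s) \<zeta> :: 'a^'n \<Rightarrow> 'a^'n)"
      using scalar_in_unitary_pair[OF z] by (simp add: unitary_pair_def)
    have "act g \<theta> $ (\<zeta> *s x)
        = (\<Sum>y\<in>UNIV. scl (kernel g $ (\<zeta> *s x) $ (\<zeta> *s y)) (\<theta> $ (\<zeta> *s y)))"
      using sum.reindex_bij_betw[OF bij, of "\<lambda>y. scl (kernel g $ (\<zeta> *s x) $ y) (\<theta> $ y)"]
      by (simp add: rho_hat_def)
    also have "\<dots> = (\<Sum>y\<in>UNIV. \<pi> ((*s) \<zeta>) (scl (kernel g $ x $ y) (\<theta> $ y)))"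
      using th z by (simp add: kernel_unitary_invariant[OF g] \<pi>_scale component_iff)
    also have "\<dots> = \<pi> ((*s) \<zeta>) (act g \<theta> $ x)"
      using V subspace_V by (simp add: rho_hat_def \<pi>_sum[OF z] V.subspace_scale)
    finally show ?thesis .
  qed
  moreover have "act g \<theta> $ x \<in> V" for x
    using V subspace_V by (simp add: rho_hat_def V.subspace_sum V.subspace_scale)
  ultimately show ?thesis by (simp add: component_iff)
qed

lemma act_mult:
  assumes "g \<in> carrier (SLstar bar)" "h \<in> carrier (SLstar bar)"
  shows "act (g \<otimes>\<^bsub>SLstar bar\<^esub> h) \<theta> = act g (act h \<theta>)"
proof -
  have "(\<Sum>y\<in>UNIV. scl (\<Sum>z\<in>UNIV. kernel g $ x $ z * kernel h $ z $ y) (\<theta> $ y))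
      = (\<Sum>z\<in>UNIV. scl (kernel g $ x $ z) (\<Sum>y\<in>UNIV. scl (kernel h $ z $ y) (\<theta> $ y)))" for x
    unfolding V.scale_sum_left V.scale_sum_right by (subst sum.swap) simp
  then show ?thesis
    by (simp add: rho_hat_def vec_eq_iff kernel_mult[OF assms] matrix_matrix_mult_def)
qed

lemma component_rep: "is_rep (SLstar bar) (pointwise_scale scl) Comp act"
proof -
  have "act \<one>\<^bsub>SLstar bar\<^esub> \<theta> $ x = \<theta> $ x" for \<theta> x
    by (simp add: rho_hat_def kernel_one mat_def if_distrib[of "\<lambda>c. scl c _"] cong: if_cong)
  then have "act \<one>\<^bsub>SLstar bar\<^esub> \<theta> = \<theta>" for \<theta>
    by (simp add: vec_eq_iff)
  moreover have "act g (\<theta> + \<eta>) = act g \<theta> + act g \<eta>" for g \<theta> \<eta>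
    by (simp add: rho_hat_def vec_eq_iff V.scale_right_distrib sum.distrib)
  moreover have "act g (pointwise_scale scl r \<theta>) = pointwise_scale scl r (act g \<theta>)" for g r \<theta>
    by (simp add: rho_hat_def vec_eq_iff V.scale_sum_right mult.commute)
  ultimately show ?thesis
    by (simp add: is_rep_def F.vector_space_axioms subspace_Comp act_closed act_mult)
qed

lemma act_u: "star bar s = s \<Longrightarrow> act (u_elt s) \<theta> $ x = scl (weil_gamma bar \<psi> s x) (\<theta> $ x)"
  by (simp add: rho_hat_def kernel_u if_distrib[of "\<lambda>c. scl c _"] cong: if_cong)

lemma act_h: "invertible t \<Longrightarrow> act (h_elt bar t) \<theta> $ x = scl (sgn' (det t)) (\<theta> $ (x v* t))"
  by (simp add: rho_hat_def kernel_h if_distrib[of "\<lambda>c. scl c _"] cong: if_cong)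

lemma act_w: "act w_elt \<theta> $ x = (\<Sum>y\<in>UNIV. scl (c * weil_chi bar \<psi> y x) (\<theta> $ y))"
  by (simp add: rho_hat_def kernel_w)

text \<open>
  A nonzero \<open>v \<in> V\<close> is spread equivariantly over the orbit of a basis vector \<open>e\<^sub>j\<close>. The scalars of
  norm one act freely on this orbit, so the value at \<open>\<zeta> e\<^sub>j\<close> can be read off from the \<open>j\<close>-th
  coordinate.
\<close>

lemma component_nonzero: "Comp \<noteq> {0}"
proof -
  obtain v where v: "v \<in> V" "v \<noteq> 0"
    using irrep V.subspace_0[OF subspace_V] unfolding is_irrep_def by blast
  obtain j :: 'n where True by simp
  define P where "P y \<longleftrightarrow> y $ j \<in> norm_one \<and> y = axis j (y $ j)" for y :: "'a^'n"
  define \<theta> :: "'v^('a^'n)" where "\<theta> = (\<chi> y. if P y then \<pi> ((*s) (y $ j)) v else 0)"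
  have P_scale: "P (\<zeta> *s y) \<longleftrightarrow> P y" if z: "\<zeta> \<in> norm_one" for \<zeta> y
  proof -
    have "(\<zeta> * y $ j) * bar (\<zeta> * y $ j) = (\<zeta> * bar \<zeta>) * (y $ j * bar (y $ j))"
      by (simp add: bar_mult mult_ac)
    then have "\<zeta> * y $ j \<in> norm_one \<longleftrightarrow> y $ j \<in> norm_one"
      using z by (simp only: norm_one_def mem_Collect_eq mult_1)
    moreover have "\<zeta> *s y = axis j (\<zeta> * y $ j) \<longleftrightarrow> y = axis j (y $ j)"
      using norm_one_neq_0[OF z] by (auto simp: vec_eq_iff axis_def)
    ultimately show ?thesis by (simp add: P_def)
  qed
  have P_norm: "y $ j \<in> norm_one" if "P y" for y
    using that by (simp add: P_def)
  have "\<theta> $ x \<in> V" for x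
    using v P_norm V.subspace_0[OF subspace_V] by (simp add: \<theta>_def \<pi>_closed)
  moreover have "\<theta> $ (\<zeta> *s x) = \<pi> ((*s) \<zeta>) (\<theta> $ x)" if "\<zeta> \<in> norm_one" for \<zeta> x
    using v P_norm that by (simp add: \<theta>_def P_scale \<pi>_mult \<pi>_0)
  ultimately have "\<theta> \<in> Comp"
    by (simp add: component_iff)
  moreover have "\<theta> $ axis j 1 = v"
    using v by (simp add: \<theta>_def P_def \<pi>_one)
  then have "\<theta> \<noteq> 0" using v(2) by (metis zero_index)
  ultimately show ?thesis by blast
qed

end

section \<open>Irreducibility\<close>

locale weil_invariant_subspace = weil_component bar \<psi> sgn' c \<rho> scl V \<pi>
  for bar :: "'a::{field,finite} \<Rightarrow> 'a" and \<psi> sgn' :: "'a \<Rightarrow> complex" and c :: complex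
    and \<rho> :: "('a, 'n::finite) block \<Rightarrow> complex^('a^'n) \<Rightarrow> complex^('a^'n)"
    and scl :: "complex \<Rightarrow> 'v::ab_group_add \<Rightarrow> 'v" and V :: "'v set"
    and \<pi> :: "('a^'n \<Rightarrow> 'a^'n) \<Rightarrow> 'v \<Rightarrow> 'v" +
  fixes W :: "('v^('a^'n)) set"
  assumes subspace_W: "F.subspace W" and W_Comp: "W \<subseteq> Comp"
    and invariant: "g \<in> carrier (SLstar bar) \<Longrightarrow> \<theta> \<in> W \<Longrightarrow> act g \<theta> \<in> W"
begin

definition restrict_orbit :: "'a^'n \<Rightarrow> 'v^('a^'n) \<Rightarrow> 'v^('a^'n)" where
  "restrict_orbit x \<theta> = (\<chi> y. if y \<in> orbit x then \<theta> $ y else 0)"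

text \<open>
  Each \<open>u\<^sub>s\<close> multiplies \<open>\<theta>\<close> pointwise by \<open>\<gamma>(s, \<cdot>)\<close>. By orthogonality, the average of these
  operators over all Hermitian \<open>s\<close>, weighted by \<open>\<gamma>(- s, x)\<close>, is the restriction to the orbit of \<open>x\<close>.
\<close>

lemma restrict_orbit_in_W:
  assumes "\<theta> \<in> W"
  shows "restrict_orbit x \<theta> \<in> W"
proof -
  let ?H = "{s :: 'a^'n^'n. star bar s = s}"
  let ?S = "\<Sum>s\<in>?H. pointwise_scale scl (weil_gamma bar \<psi> (- s) x) (act (u_elt s) \<theta>)"
  have "?S \<in> W"
    using assms by (intro F.subspace_sum F.subspace_scale subspace_W invariant u_elt_in_SLstar) auto
  then have "pointwise_scale scl (inverse (of_nat (card ?H))) ?S \<in> W"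
    by (rule F.subspace_scale[OF subspace_W])
  moreover have "?S $ y = scl (of_nat (card ?H)) (restrict_orbit x \<theta> $ y)" for y
  proof -
    have "?S $ y = (\<Sum>s\<in>?H. scl (weil_gamma bar \<psi> (- s) x * weil_gamma bar \<psi> s y) (\<theta> $ y))"
      by (simp add: act_u)
    also have "\<dots> = scl (if y \<in> orbit x then of_nat (card ?H) else 0) (\<theta> $ y)"
      by (simp only: gamma_orthogonality flip: V.scale_sum_left)
    finally show ?thesis by (simp add: restrict_orbit_def)
  qed
  moreover have "card ?H \<noteq> 0"
    using star_0 by auto
  ultimately show ?thesis
    by (metis (no_types, lifting) F.scale_one F.scale_scale left_inverse of_nat_eq_0_iff
        pointwise_scale_nth vec_eq_iff)
qed

lemma translate_in_W:
  assumes "\<theta> \<in> W" "invertible t"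
  shows "(\<chi> x. \<theta> $ (x v* t)) \<in> W"
proof -
  have "pointwise_scale scl (sgn' (det t)) (act (h_elt bar t) \<theta>) \<in> W"
    using assms by (intro F.subspace_scale subspace_W invariant h_elt_in_SLstar)
  also have "pointwise_scale scl (sgn' (det t)) (act (h_elt bar t) \<theta>) = (\<chi> x. \<theta> $ (x v* t))"
    using assms by (simp add: vec_eq_iff act_h sgn_det_square)
  finally show ?thesis .
qed

text \<open>
  If all functions in \<open>W\<close> were supported at the origin, then \<open>w\<close>, which acts as a Fourier
  transform, would turn a nonzero one into a nonzero constant function.
\<close>

lemma nonzero_off_origin:
  assumes "W \<noteq> {0}"
  shows "\<exists>\<theta>\<in>W. \<exists>x. x \<noteq> 0 \<and> \<theta> $ x \<noteq> 0"
proof (rule ccontr)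
  assume "\<not> ?thesis"
  then have supp: "\<theta> $ x = 0" if "\<theta> \<in> W" "x \<noteq> 0" for \<theta> x using that by blast
  obtain \<theta> where \<theta>: "\<theta> \<in> W" "\<theta> \<noteq> 0"
    using assms F.subspace_0[OF subspace_W] by blast
  then have "\<theta> $ 0 \<noteq> 0" using supp by (metis vec_eq_iff zero_index)
  \<comment> \<open>Any nonzero point serves, so the index is arbitrary.\<close>
  let ?x = "axis undefined 1 :: 'a^'n"
  have "?x \<noteq> 0" by simp
  have "act w_elt \<theta> $ ?x = (\<Sum>y::'a^'n\<in>UNIV. if y = 0 then scl c (\<theta> $ 0) else 0)"
    unfolding act_w by (intro sum.cong) (auto simp: supp \<theta> weil_chi_def herm_form_def \<psi>_0)
  also have "\<dots> \<noteq> 0" using \<open>\<theta> $ 0 \<noteq> 0\<close> c_neq_0 by simp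
  finally show False
    using supp[OF invariant[OF w_elt_in_SLstar \<theta>(1)] \<open>?x \<noteq> 0\<close>] by simp
qed

text \<open>
  The values that \<open>W\<close> attains at a point form a subspace of \<open>V\<close>. It is stable under the unitary
  group, because a norm one scalar can be applied to the argument through \<open>h\<close> and equivariance moves
  it to the value; so irreducibility of \<open>V\<close> makes it all of \<open>V\<close> at one nonzero point. As \<open>h\<^sub>t\<close>
  translates the argument by \<open>t\<close>, transitivity carries this to every nonzero point.
\<close>

lemma evaluation_surjective:
  assumes "W \<noteq> {0}" "x \<noteq> 0" "v \<in> V"
  shows "\<exists>\<theta>\<in>W. \<theta> $ x = v"
proof -
  obtain \<theta>0 x0 where \<theta>0: "\<theta>0 \<in> W" "x0 \<noteq> 0" "\<theta>0 $ x0 \<noteq> 0"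
    using nonzero_off_origin assms(1) by blast
  define S where "S = (\<lambda>\<theta>. \<theta> $ x0) ` W"
  have mem: "\<theta> $ y \<in> V" "\<zeta> \<in> norm_one \<Longrightarrow> \<theta> $ (\<zeta> *s y) = \<pi> ((*s) \<zeta>) (\<theta> $ y)"
    if "\<theta> \<in> W" for \<theta> y \<zeta>
    using that W_Comp by (auto simp: component_iff)
  have "V.subspace S"
    unfolding V.subspace_def S_def
  proof (intro conjI ballI allI)
    show "0 \<in> (\<lambda>\<theta>. \<theta> $ x0) ` W"
      using F.subspace_0[OF subspace_W] by (rule rev_image_eqI) simp
  next
    fix a b assume "a \<in> (\<lambda>\<theta>. \<theta> $ x0) ` W" "b \<in> (\<lambda>\<theta>. \<theta> $ x0) ` W"
    then obtain \<theta> \<eta> where *: "\<theta> \<in> W" "\<eta> \<in> W" "a = \<theta> $ x0" "b = \<eta> $ x0" by blast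
    show "a + b \<in> (\<lambda>\<theta>. \<theta> $ x0) ` W"
      by (rule rev_image_eqI[OF F.subspace_add[OF subspace_W *(1,2)]]) (simp add: *)
  next
    fix r a assume "a \<in> (\<lambda>\<theta>. \<theta> $ x0) ` W"
    then obtain \<theta> where *: "\<theta> \<in> W" "a = \<theta> $ x0" by blast
    have "pointwise_scale scl r \<theta> \<in> W"
      by (intro F.subspace_scale subspace_W *)
    then show "scl r a \<in> (\<lambda>\<theta>. \<theta> $ x0) ` W"
      by (rule rev_image_eqI) (simp add: *)
  qed
  moreover have "S \<subseteq> V" using mem(1) by (auto simp: S_def)
  moreover have "S \<noteq> {0}" using \<theta>0 by (auto simp: S_def)
  moreover have "\<pi> ((*s) \<zeta>) u \<in> S" if z: "\<zeta> \<in> norm_one" and u: "u \<in> S" for \<zeta> u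
  proof -
    obtain \<theta> where \<theta>: "\<theta> \<in> W" "u = \<theta> $ x0" using u by (auto simp: S_def)
    have "(\<chi> x. \<theta> $ (x v* mat \<zeta>)) \<in> W"
      using \<theta> z by (intro translate_in_W invertible_mat_norm_one)
    then show ?thesis
      unfolding S_def by (rule rev_image_eqI) (simp add: vector_matrix_mult_mat mem(2) \<theta> z)
  qed
  ultimately have "S = V" by (rule V_irreducible)
  then obtain \<theta> where \<theta>: "\<theta> \<in> W" "\<theta> $ x0 = v"
    using assms(3) by (auto simp: S_def)
  obtain t where "invertible t" "x v* t = x0"
    using invertible_matrix_transitive assms(2) \<theta>0(2) by blast
  then show ?thesis
    using translate_in_W[OF \<theta>(1)] \<theta>(2) by (intro bexI[of _ "\<chi> x. \<theta> $ (x v* t)"]) auto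
qed

text \<open>
  At nonzero points this is \<open>evaluation_surjective\<close>. At the origin the value \<open>v\<close> of an equivariant
  function is fixed by the unitary group, so there is a function in \<open>W\<close> that is constantly \<open>v\<close> on
  one nonzero orbit and zero elsewhere. The value of its image under \<open>w\<close> at the origin is, up to
  \<open>c\<close>, the sum of its values, a nonzero multiple of \<open>v\<close>.
\<close>

lemma values_attained:
  assumes "W \<noteq> {0}" "\<theta> \<in> Comp"
  shows "\<exists>\<eta>\<in>W. \<eta> $ x = \<theta> $ x"
proof (cases "x = 0")
  case False
  then show ?thesis
    using evaluation_surjective assms by (simp add: component_iff)
next
  case True
  let ?v = "\<theta> $ 0"
  have v: "?v \<in> V" "\<pi> ((*s) \<zeta>) ?v = ?v" if "\<zeta> \<in> norm_one" for \<zeta>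
  proof -
    show "?v \<in> V" using assms(2) by (simp add: component_iff)
    have "\<theta> $ (\<zeta> *s 0) = \<pi> ((*s) \<zeta>) ?v"
      using assms(2) that unfolding component_iff by blast
    then show "\<pi> ((*s) \<zeta>) ?v = ?v" by simp
  qed
  let ?e = "axis undefined 1 :: 'a^'n"
  have "?e \<noteq> 0" by simp
  then obtain \<eta> where \<eta>: "\<eta> \<in> W" "\<eta> $ ?e = ?v"
    using evaluation_surjective[OF assms(1) _ v(1)[OF norm_one_1]] by blast
  define r where "r = c * of_nat (card (orbit ?e))"
  have "r \<noteq> 0" by (simp add: r_def c_neq_0)
  have \<eta>_orbit: "\<eta> $ y = ?v" if "y \<in> orbit ?e" for y
    using that \<eta> v(2) W_Comp by (auto simp: orbit_def component_iff)
  have "act w_elt (restrict_orbit ?e \<eta>) $ 0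
      = (\<Sum>y\<in>UNIV. if y \<in> orbit ?e then scl c ?v else 0)"
    unfolding act_w
    by (intro sum.cong) (auto simp: restrict_orbit_def \<eta>_orbit weil_chi_def herm_form_def \<psi>_0)
  also have "\<dots> = (\<Sum>y\<in>orbit ?e. scl c ?v)"
    by (simp add: sum.If_cases)
  also have "\<dots> = scl r ?v"
    by (simp add: V.sum_constant_scale r_def mult.commute)
  finally have "pointwise_scale scl (inverse r) (act w_elt (restrict_orbit ?e \<eta>)) $ x = \<theta> $ x"
    using True \<open>r \<noteq> 0\<close> by simp
  moreover have "pointwise_scale scl (inverse r) (act w_elt (restrict_orbit ?e \<eta>)) \<in> W"
    by (intro F.subspace_scale[OF subspace_W] invariant w_elt_in_SLstar restrict_orbit_in_W \<eta>)
  ultimately show ?thesis by blast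
qed

lemma restrict_orbit_cong:
  assumes "\<theta> \<in> Comp" "\<eta> \<in> Comp" "\<eta> $ x = \<theta> $ x"
  shows "restrict_orbit x \<eta> = restrict_orbit x \<theta>"
  using assms by (auto simp: restrict_orbit_def vec_eq_iff component_iff orbit_def)

text \<open>
  Summing over all points rather than over representatives of the orbits counts each orbit as often
  as it has elements, whence the weights.
\<close>

lemma sum_restrict_orbit:
  "(\<Sum>x\<in>UNIV. pointwise_scale scl (1 / of_nat (card (orbit x))) (restrict_orbit x \<theta>)) = \<theta>"
proof -
  have "(\<Sum>x\<in>UNIV. scl (1 / of_nat (card (orbit x))) (restrict_orbit x \<theta> $ y)) = \<theta> $ y" for y
  proof -
    have "y \<in> orbit x \<longleftrightarrow> x \<in> orbit y" for x
      using orbit_sym by blast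
    then have "(\<Sum>x\<in>UNIV. scl (1 / of_nat (card (orbit x))) (restrict_orbit x \<theta> $ y))
        = (\<Sum>x\<in>UNIV. if x \<in> orbit y then scl (1 / of_nat (card (orbit y))) (\<theta> $ y) else 0)"
      by (intro sum.cong) (auto simp: restrict_orbit_def dest!: orbit_eq)
    also have "\<dots> = (\<Sum>x\<in>orbit y. scl (1 / of_nat (card (orbit y))) (\<theta> $ y))"
      by (simp add: sum.If_cases)
    also have "\<dots> = \<theta> $ y"
      by (simp add: V.sum_constant_scale)
    finally show ?thesis .
  qed
  then show ?thesis by (simp add: vec_eq_iff)
qed

text \<open>
  An equivariant function is determined on an orbit by its value at one point of it, and \<open>W\<close> attains
  this value; hence \<open>W\<close> contains every orbit restriction of every equivariant function.
\<close>

lemma W_eq_Comp: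
  assumes "W \<noteq> {0}"
  shows "W = Comp"
proof
  show "Comp \<subseteq> W"
  proof
    fix \<theta> assume \<theta>: "\<theta> \<in> Comp"
    have "restrict_orbit x \<theta> \<in> W" for x
      using values_attained[OF assms \<theta>] restrict_orbit_cong[OF \<theta>] W_Comp restrict_orbit_in_W
      by (metis subsetD)
    then have "(\<Sum>x\<in>UNIV. pointwise_scale scl (1 / of_nat (card (orbit x))) (restrict_orbit x \<theta>)) \<in> W"
      by (intro F.subspace_sum F.subspace_scale subspace_W)
    then show "\<theta> \<in> W" by (simp only: sum_restrict_orbit)
  qed
qed (rule W_Comp)

end

theorem corollary6p2:
  fixes q :: nat
    and k :: "'a::{field,finite} set"
    and bar :: "'a \<Rightarrow> 'a"
    and \<psi> sgn' :: "'a \<Rightarrow> complex"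
    and c :: complex
    and \<rho> :: "('a, 'n::finite) block \<Rightarrow> complex^('a^'n) \<Rightarrow> complex^('a^'n)"
    and scl :: "complex \<Rightarrow> 'v::ab_group_add \<Rightarrow> 'v"
    and V :: "'v set"
    and \<pi> :: "('a^'n \<Rightarrow> 'a^'n) \<Rightarrow> 'v \<Rightarrow> 'v"
  assumes "primepow q" "odd q" "q > 3"
    and "is_subfield k" "card k = q" "CARD('a) = q ^ 2"
    and "nontrivial_automorphism_over k bar"
    and "nontrivial_additive_character \<psi>" "\<And>x. \<psi> (bar x) = \<psi> x"
    and "nontrivial_quadratic_character sgn'"
    and "c = - 1 / of_nat q ^ CARD('n) \<or> c = (- 1) ^ CARD('n) / of_nat q ^ CARD('n)"
    and "is_weil_rep bar \<psi> sgn' c \<rho>"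
    and "is_irrep (unitary_pair bar \<psi>) scl V \<pi>"
  shows "is_irrep (SLstar bar) (pointwise_scale scl)
           (component (unitary_pair bar \<psi>) V \<pi>) (rho_hat \<rho> scl)"
proof -
  have "odd (CARD('a))" using assms(2,6) by simp
  have "c \<noteq> 0" using assms(3,11) by auto
  interpret weil_component bar \<psi> sgn' c \<rho> scl V \<pi>
  proof unfold_locales
    show "bar (x + y) = bar x + bar y" "bar (x * y) = bar x * bar y" for x y
      using assms(7) by (auto simp: nontrivial_automorphism_over_def)
    show "bar (bar x) = x" for x
      by (rule quadratic_extension_bar_involution[OF assms(4-7)])
    show "(2::'a) \<noteq> 0"
      by (rule two_neq_zero_if_odd_card) fact
  qed (use assms \<open>c \<noteq> 0\<close> in auto)
  show ?thesis
    unfolding is_irrep_def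
  proof (intro conjI allI impI)
    fix W assume W: "module.subspace (pointwise_scale scl) W" "W \<subseteq> Comp"
      "\<forall>g\<in>carrier (SLstar bar). \<forall>\<theta>\<in>W. act g \<theta> \<in> W"
    interpret weil_invariant_subspace bar \<psi> sgn' c \<rho> scl V \<pi> W
      by unfold_locales (use W in auto)
    show "W = {0} \<or> W = Comp" using W_eq_Comp by blast
  qed (rule component_rep component_nonzero)+
qed

end
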